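(* Suppose that $M$ is a finite-dimensional complex left central Leibniz algebra. Then $\psi$ is associative, in the sense that for all $a,b,c\in M$ we have $$\psi([ab],c)=\psi(a,[bc]).$$ In particular, the radical $R$ of $M$ is a $2$-sided ideal of $M$.
   Context: A left Leibniz algebra is a (nonassociative) $\mathbb{C}$-algebra $M$ with product $[\ ]$ satisfying $[a[bc]]=[[ab]c]+[b[ac]]$ for all $a,b,c\in M$. It is left central if in addition $[a[bb]]=0$ for all $a,b\in M$. All algebras are finite-dimensional over $\mathbb{C}$. The Leibniz kernel $C(M)$ is the span of all $[aa]$, $a\in M$, and $\psi:M\times M\to C(M)$ is the symmetric bilinear map $\psi(a,b)=[ab]+[ba]$. The radical is $R=\{x\in M\mid\psi(x,a)=0\text{ for all }a\in M\}$. *)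

theory Defs
  imports Complex_Main
begin

text \<open>The algebras live on a whole type; a product is a curried function \<open>br\<close>,
  with \<open>br a b\<close> standing for $[ab]$.\<close>

locale complex_algebra = vector_space scale
  for scale :: "complex \<Rightarrow> 'm::ab_group_add \<Rightarrow> 'm" +
  fixes br :: "'m \<Rightarrow> 'm \<Rightarrow> 'm"
  assumes linear_right: "Vector_Spaces.linear scale scale (\<lambda>b. br a b)"
    and linear_left: "Vector_Spaces.linear scale scale (\<lambda>a. br a b)"
    and finite_dimensional: "\<exists>B. finite_dimensional_vector_space scale B"

locale left_leibniz_algebra = complex_algebra scale br
  for scale :: "complex \<Rightarrow> 'm::ab_group_add \<Rightarrow> 'm" and br :: "'m \<Rightarrow> 'm \<Rightarrow> 'm" +
  assumes left_leibniz: "br a (br b c) = br (br a b) c + br b (br a c)"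

locale left_central_leibniz_algebra = left_leibniz_algebra scale br
  for scale :: "complex \<Rightarrow> 'm::ab_group_add \<Rightarrow> 'm" and br :: "'m \<Rightarrow> 'm \<Rightarrow> 'm" +
  assumes left_central: "br a (br b b) = 0"

definition leibniz_kernel ::
    "(complex \<Rightarrow> 'm::ab_group_add \<Rightarrow> 'm) \<Rightarrow> ('m \<Rightarrow> 'm \<Rightarrow> 'm) \<Rightarrow> 'm set"
  where "leibniz_kernel scale br = module.span scale (range (\<lambda>a. br a a))"

text \<open>The map $\psi$ is typed with codomain the whole algebra; that its values lie in the
  Leibniz kernel is \<open>leibniz_psi_in_kernel\<close> below.\<close>

definition leibniz_psi :: "('m::ab_group_add \<Rightarrow> 'm \<Rightarrow> 'm) \<Rightarrow> 'm \<Rightarrow> 'm \<Rightarrow> 'm"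
  where "leibniz_psi br a b = br a b + br b a"

definition leibniz_radical :: "('m::ab_group_add \<Rightarrow> 'm \<Rightarrow> 'm) \<Rightarrow> 'm set"
  where "leibniz_radical br = {x. \<forall>a. leibniz_psi br x a = 0}"

definition two_sided_ideal ::
    "(complex \<Rightarrow> 'm::ab_group_add \<Rightarrow> 'm) \<Rightarrow> ('m \<Rightarrow> 'm \<Rightarrow> 'm) \<Rightarrow> 'm set \<Rightarrow> bool"
  where "two_sided_ideal scale br I \<longleftrightarrow>
    module.subspace scale I \<and> (\<forall>a. \<forall>x\<in>I. br a x \<in> I \<and> br x a \<in> I)"

lemma leibniz_psi_commute: "leibniz_psi br a b = leibniz_psi br b a"
  by (simp add: leibniz_psi_def add.commute)

context complex_algebra
begin

lemma br_add_right: "br a (b + c) = br a b + br a c"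
  by (rule module_hom.add[OF linear_right[unfolded linear_iff_module_hom]])

lemma br_add_left: "br (a + b) c = br a c + br b c"
  by (rule module_hom.add[OF linear_left[unfolded linear_iff_module_hom]])

lemma br_scale_right: "br a (scale r b) = scale r (br a b)"
  by (rule module_hom.scale[OF linear_right[unfolded linear_iff_module_hom]])

lemma br_scale_left: "br (scale r a) b = scale r (br a b)"
  by (rule module_hom.scale[OF linear_left[unfolded linear_iff_module_hom]])

lemma linear_leibniz_psi: "Vector_Spaces.linear scale scale (leibniz_psi br a)"
  by unfold_locales
    (simp_all add: leibniz_psi_def br_add_right br_add_left br_scale_right br_scale_left
      scale_right_distrib add_ac)

lemma leibniz_psi_in_kernel: "leibniz_psi br a b \<in> leibniz_kernel scale br"
proof -
  have "leibniz_psi br a b = br (a + b) (a + b) - br a a - br b b"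
    by (simp add: leibniz_psi_def br_add_right br_add_left algebra_simps)
  then show ?thesis
    unfolding leibniz_kernel_def by (simp add: span_diff span_base)
qed

end

end

theory Submission
  imports Defs
begin

text \<open>The values of $\psi$ annihilate the algebra from both sides, so $\psi([ab],c)$ is
  skew-symmetric in $a,b$. Left multiplication by $a$ is a derivation, and $[a\,\psi(b,c)] = 0$
  makes it skew-adjoint for $\psi$. The two sign changes cancel.\<close>

context complex_algebra
begin

lemma leibniz_psi_add_left:
  "leibniz_psi br (a + b) c = leibniz_psi br a c + leibniz_psi br b c"
  by (simp add: leibniz_psi_def br_add_left br_add_right add_ac)

text \<open>Lets a law about squares pass to the values of \<psi>.\<close>

lemma leibniz_psi_polarization: "br (a + b) (a + b) = br a a + leibniz_psi br a b + br b b"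
  by (simp add: leibniz_psi_def br_add_left br_add_right add_ac)

lemma leibniz_psi_scale_left: "leibniz_psi br (scale r a) c = scale r (leibniz_psi br a c)"
  by (simp add: leibniz_psi_def br_scale_left br_scale_right scale_right_distrib)

lemma leibniz_psi_zero_left: "leibniz_psi br 0 c = 0"
  using leibniz_psi_scale_left[of 0 0 c] by simp

lemma subspace_leibniz_radical: "subspace (leibniz_radical br)"
  by (rule subspaceI)
    (simp_all add: leibniz_radical_def leibniz_psi_zero_left leibniz_psi_add_left
      leibniz_psi_scale_left)

end

text \<open>Adding the Leibniz identity to its copy with \<open>a\<close> and \<open>b\<close>
  exchanged cancels [a[bc]] and [b[ac]], leaving [[ab]c] + [[ba]c] = 0.\<close>

lemma (in left_leibniz_algebra) br_leibniz_psi_left: "br (leibniz_psi br a b) c = 0"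
  using left_leibniz[of a b c] left_leibniz[of b a c]
  by (simp add: leibniz_psi_def br_add_left)

context left_central_leibniz_algebra
begin

text \<open>Polarize left centrality: apply it to the square of \<open>b + c\<close> and drop the
  two pure squares.\<close>

lemma br_leibniz_psi_right: "br a (leibniz_psi br b c) = 0"
  using left_central[of a "b + c"] unfolding leibniz_psi_polarization
  by (simp add: br_add_right left_central)

lemma leibniz_psi_skew_left: "leibniz_psi br (br a b) c = - leibniz_psi br (br b a) c"
proof -
  have "leibniz_psi br (leibniz_psi br a b) c = 0"
    \<comment> \<open>Only the outer \<psi> is unfolded; the inner one stays folded so that both
      annihilation lemmas apply.\<close>
    by (subst leibniz_psi_def) (simp add: br_leibniz_psi_left br_leibniz_psi_right)
  then show ?thesis
    by (simp add: leibniz_psi_def[of br a b] leibniz_psi_add_left eq_neg_iff_add_eq_0)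
qed

lemma leibniz_psi_skew_adjoint: "leibniz_psi br (br a b) c = - leibniz_psi br b (br a c)"
proof -
  \<comment> \<open>The derivation rule for [bc] and for [cb], added together.\<close>
  have "br a (leibniz_psi br b c) = leibniz_psi br (br a b) c + leibniz_psi br b (br a c)"
    using left_leibniz[of a b c] left_leibniz[of a c b]
    by (simp add: leibniz_psi_def br_add_right add_ac)
  then show ?thesis
    by (simp add: br_leibniz_psi_right eq_neg_iff_add_eq_0)
qed

lemma leibniz_psi_assoc: "leibniz_psi br (br a b) c = leibniz_psi br a (br b c)"
  using leibniz_psi_skew_left[of a b c] leibniz_psi_skew_adjoint[of b a c] by simp

lemma two_sided_ideal_leibniz_radical: "two_sided_ideal scale br (leibniz_radical br)"
  unfolding two_sided_ideal_def
proof (intro conjI allI ballI)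
  show "subspace (leibniz_radical br)"
    by (rule subspace_leibniz_radical)
  fix a x
  assume "x \<in> leibniz_radical br"
  then have x: "leibniz_psi br x c = 0" for c
    by (simp add: leibniz_radical_def)
  \<comment> \<open>Skew-adjointness turns \<psi>([ax],c) into -\<psi>(x,[ac]), which vanishes; for
    [xa] below, associativity gives \<psi>(x,[ac]) itself.\<close>
  show "br a x \<in> leibniz_radical br"
    by (simp add: leibniz_radical_def leibniz_psi_skew_adjoint x)
  show "br x a \<in> leibniz_radical br"
    by (simp add: leibniz_radical_def leibniz_psi_assoc x)
qed

end

theorem lemma1:
  fixes scale :: "complex \<Rightarrow> 'm::ab_group_add \<Rightarrow> 'm"
    and br :: "'m \<Rightarrow> 'm \<Rightarrow> 'm"
  assumes "left_central_leibniz_algebra scale br"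
  shows "(\<forall>a b c. leibniz_psi br (br a b) c = leibniz_psi br a (br b c)) \<and>
    two_sided_ideal scale br (leibniz_radical br)"
proof -
  interpret left_central_leibniz_algebra scale br
    by (rule assms)
  show ?thesis
    using leibniz_psi_assoc two_sided_ideal_leibniz_radical by blast
qed

end
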